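(* Let $1<p<q<\infty$ and let $p^*=p/(p-1)$, $q^*=q/(q-1)$. For $(x,y)\in(0,1)^2$, the system $$ S(p,q):\quad\left\{ \begin{aligned} &\frac{1}{1+2x}\Big(\frac{1+2x^p}{3}\Big)^{1/p}=\frac{1}{1+2y}\Big(\frac{1+2y^q}{3}\Big)^{1/q},\\ &\frac{(1-x)(1-x^{p-1})}{1+2x^p}=\frac{(1-y)(1-y^{q-1})}{1+2y^q} \end{aligned} \right. $$ is equivalent to $$ \left\{ \begin{aligned} \ell(p,x)&=\ell(q,y),\\ \ell(p^*,x^{p-1})&=\ell(q^*,y^{q-1}). \end{aligned} \right. $$ In particular, the solutions are invariant under the transform $(p,q,x,y)\mapsto(q^*,p^*,y^{q-1},x^{p-1})$, that is, $(x,y)\in(0,1)^2$ solves $S(p,q)$ if and only if $(y^{q-1},x^{p-1})$ solves $S(q^*,p^* )$. Moreover, if $(x,y)\in(0,1)^2$ solves $S(p,q)$, then $$ (x,y;-1/2,1)=(y^{q-1},x^{p-1};-1/2,1). $$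
   Context: For $1<p<\infty$ and $x\in(0,1)$, $\ell(p,x):=\frac{1}{1+2x}\big(\frac{1+2x^p}{3}\big)^{1/p}$. The cross ratio is $(x,y;-1/2,1):=\frac{(x+1/2)(y-1)}{(x-1)(y+1/2)}$. *)

theory Defs
  imports Complex_Main
begin

definition ell :: "real \<Rightarrow> real \<Rightarrow> real" where
  "ell p x = 1 / (1 + 2 * x) * ((1 + 2 * x powr p) / 3) powr (1 / p)"

definition conj_exponent :: "real \<Rightarrow> real" where
  "conj_exponent p = p / (p - 1)"

definition cross_ratio :: "real \<Rightarrow> real \<Rightarrow> real \<Rightarrow> real \<Rightarrow> real" where
  "cross_ratio a b c d = ((a - c) * (b - d)) / ((a - d) * (b - c))"

definition solves_S :: "real \<Rightarrow> real \<Rightarrow> real \<Rightarrow> real \<Rightarrow> bool" where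
  "solves_S p q x y \<longleftrightarrow>
     x \<in> {0<..<1} \<and> y \<in> {0<..<1} \<and>
     1 / (1 + 2 * x) * ((1 + 2 * x powr p) / 3) powr (1 / p)
       = 1 / (1 + 2 * y) * ((1 + 2 * y powr q) / 3) powr (1 / q) \<and>
     (1 - x) * (1 - x powr (p - 1)) / (1 + 2 * x powr p)
       = (1 - y) * (1 - y powr (q - 1)) / (1 + 2 * y powr q)"

end

theory Submission
  imports Defs
begin

text \<open>
  Put \<open>a = x\<^sup>p\<^sup>-\<^sup>1\<close> and \<open>R = (1 - x) (1 - a) / (1 + 2 x a)\<close>, and note that \<open>x\<^sup>p = x a\<close> and
  \<open>1/p + 1/p\<^sup>* = 1\<close>. The identity \<open>(1 + 2 x) (1 + 2 a) = 3 (1 + 2 x a) - 2 (1 - x) (1 - a)\<close> yields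
  \<open>\<ell>(p, x) \<ell>(p\<^sup>*, a) = 1 / (3 (3 - 2 R))\<close>, so that, once the values of \<open>\<ell>(p, x)\<close> agree, the
  values of \<open>R\<close> agree iff those of \<open>\<ell>(p\<^sup>*, a)\<close> do. The resulting system is visibly invariant
  under the involution \<open>(p, x) \<mapsto> (p\<^sup>*, a)\<close>. The cross ratio identity is a rearrangement of the equality
  of the two values of \<open>(3 - 2 R) / R = (1 + 2 x) (1 + 2 a) / ((1 - x) (1 - a))\<close>.
\<close>

definition ratio :: "real \<Rightarrow> real \<Rightarrow> real" where
  "ratio x a = (1 - x) * (1 - a) / (1 + 2 * (x * a))"

lemma one_plus_two_mult_pos:
  fixes x a :: real
  assumes "0 < x" "0 < a"
  shows "0 < 1 + 2 * (x * a)"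
  using mult_pos_pos[OF assms] by linarith

lemma three_minus_two_ratio:
  assumes "0 < x" "0 < a"
  shows "3 - 2 * ratio x a = (1 + 2 * x) * (1 + 2 * a) / (1 + 2 * (x * a))"
  using one_plus_two_mult_pos[OF assms] unfolding ratio_def by (simp add: field_simps)

lemma powr_minus_one_in_unit_interval:
  fixes x p :: real
  assumes "1 < p" "x \<in> {0<..<1}"
  shows "x powr (p - 1) \<in> {0<..<1}"
  using assms powr_less_mono2[of "p - 1" x 1] by simp

lemma mult_powr_minus_one:
  fixes x p :: real
  assumes "0 < x"
  shows "x * x powr (p - 1) = x powr p"
  using assms by (simp add: powr_diff)

lemma conj_exponent_gt_one: "1 < p \<Longrightarrow> 1 < conj_exponent p"
  by (simp add: conj_exponent_def field_simps)

lemma conj_exponent_conj_exponent: "1 < p \<Longrightarrow> conj_exponent (conj_exponent p) = p"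
  by (simp add: conj_exponent_def field_simps)

text \<open>Because (p - 1) p* = p, \<open>ell p x\<close> and
  \<open>ell (conj_exponent p) (x powr (p - 1))\<close> take roots of the same number.\<close>

lemma powr_powr_conj_exponent:
  assumes "1 < p"
  shows "(x powr (p - 1)) powr conj_exponent p = x powr p"
  using assms by (simp add: powr_powr conj_exponent_def)

lemma powr_powr_conj_exponent_minus_one:
  assumes "1 < p" "0 < x"
  shows "(x powr (p - 1)) powr (conj_exponent p - 1) = x"
proof -
  have "(p - 1) * (conj_exponent p - 1) = 1"
    using assms by (simp add: conj_exponent_def field_simps)
  then show ?thesis
    using assms by (simp add: powr_powr)
qed

lemma inverse_conj_exponent: "1 < p \<Longrightarrow> 1 / p + 1 / conj_exponent p = 1"
  by (simp add: conj_exponent_def field_simps)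

lemma ell_pos: "0 < x \<Longrightarrow> 0 < ell p x"
proof -
  assume "0 < x"
  moreover have "0 < 1 + 2 * x powr p"
    by (rule add_pos_nonneg) simp_all
  ultimately show ?thesis
    by (simp add: ell_def)
qed

text \<open>Both roots have base (1 + 2 x a) / 3, and their exponents 1/p and 1/p* add up to 1, so
  their product is the base itself. The linear prefactors are then absorbed by
  \<open>three_minus_two_ratio\<close>.\<close>

lemma ell_mult_ell_conj:
  assumes "1 < p" "x \<in> {0<..<1}"
  defines "a \<equiv> x powr (p - 1)"
  shows "ell p x * ell (conj_exponent p) a = 1 / (3 * (3 - 2 * ratio x a))"
proof -
  let ?D = "1 + 2 * (x * a)"
  have x: "0 < x" and a: "0 < a"
    using assms by (simp_all add: a_def)
  have D: "0 < ?D"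
    using x a by (rule one_plus_two_mult_pos)
  have xa: "x powr p = x * a" "a powr conj_exponent p = x * a"
    using x assms(1) by (simp_all add: a_def powr_powr_conj_exponent mult_powr_minus_one)
  have "(?D / 3) powr (1 / p) * (?D / 3) powr (1 / conj_exponent p) = ?D / 3"
    using D assms(1) by (simp add: inverse_conj_exponent flip: powr_add)
  then have "ell p x * ell (conj_exponent p) a = 1 / (1 + 2 * x) * (1 / (1 + 2 * a)) * (?D / 3)"
    unfolding ell_def xa by (simp only: mult.assoc mult.left_commute)
  also have "\<dots> = 1 / (3 * (3 - 2 * ratio x a))"
    unfolding three_minus_two_ratio[OF x a] by simp
  finally show ?thesis .
qed

lemma solves_S_iff_ratio:
  assumes "x \<in> {0<..<1}" "y \<in> {0<..<1}"
  shows "solves_S p q x y \<longleftrightarrow>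
    ell p x = ell q y \<and> ratio x (x powr (p - 1)) = ratio y (y powr (q - 1))"
  using assms by (simp add: solves_S_def ell_def ratio_def mult_powr_minus_one)

lemma solves_S_iff_ell:
  assumes "1 < p" "1 < q" "x \<in> {0<..<1}" "y \<in> {0<..<1}"
  shows "solves_S p q x y \<longleftrightarrow>
    ell p x = ell q y \<and>
    ell (conj_exponent p) (x powr (p - 1)) = ell (conj_exponent q) (y powr (q - 1))"
proof -
  let ?a = "x powr (p - 1)" and ?b = "y powr (q - 1)"
  have "ratio x ?a = ratio y ?b \<longleftrightarrow> ell (conj_exponent p) ?a = ell (conj_exponent q) ?b"
    if "ell p x = ell q y"
  proof -
    \<comment> \<open>The map t \<mapsto> 1 / (3 (3 - 2 t)) is injective on all reals: with
      \<open>1 / 0 = 0\<close>, inversion is a bijection.\<close>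
    have "ratio x ?a = ratio y ?b \<longleftrightarrow>
        1 / (3 * (3 - 2 * ratio x ?a)) = 1 / (3 * (3 - 2 * ratio y ?b))"
      by simp
    \<comment> \<open>The assumed equality lets \<open>ell p x\<close> replace
      \<open>ell q y\<close> in the right-hand product; this common positive factor cancels
      next.\<close>
    also have "\<dots> \<longleftrightarrow> ell p x * ell (conj_exponent p) ?a = ell p x * ell (conj_exponent q) ?b"
      using ell_mult_ell_conj[of p x] ell_mult_ell_conj[of q y] assms that by simp
    also have "\<dots> \<longleftrightarrow> ell (conj_exponent p) ?a = ell (conj_exponent q) ?b"
      using ell_pos[of x p] assms by simp
    finally show ?thesis .
  qed
  then show ?thesis
    using assms by (auto simp: solves_S_iff_ratio)
qed

lemma solves_S_conj_iff:
  assumes "1 < p" "1 < q" "x \<in> {0<..<1}" "y \<in> {0<..<1}"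
  shows "solves_S p q x y \<longleftrightarrow>
    solves_S (conj_exponent q) (conj_exponent p) (y powr (q - 1)) (x powr (p - 1))"
proof -
  let ?a = "x powr (p - 1)" and ?b = "y powr (q - 1)"
  have ab: "?a \<in> {0<..<1}" "?b \<in> {0<..<1}"
    using assms powr_minus_one_in_unit_interval by blast+
  have inv: "?a powr (conj_exponent p - 1) = x" "?b powr (conj_exponent q - 1) = y"
    using assms by (simp_all add: powr_powr_conj_exponent_minus_one)
  \<comment> \<open>For the conjugate data the characterization gives the same two equations, with
    their order and their sides exchanged.\<close>
  have "solves_S (conj_exponent q) (conj_exponent p) ?b ?a \<longleftrightarrow>
      ell (conj_exponent q) ?b = ell (conj_exponent p) ?a \<and> ell q y = ell p x"
    using solves_S_iff_ell[OF conj_exponent_gt_one[OF assms(2)] conj_exponent_gt_one[OF assms(1)] ab(2,1)]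
    unfolding inv conj_exponent_conj_exponent[OF assms(1)] conj_exponent_conj_exponent[OF assms(2)] .
  then show ?thesis
    unfolding solves_S_iff_ell[OF assms] by auto
qed

text \<open>Let f(s) = (1 + 2 s) / (1 - s). Equal ratios give f(x) f(a) = f(y) f(b), and the cross
  ratio of s, t with -1/2, 1 is f(s) / f(t); hence f(x) / f(y) = f(b) / f(a).\<close>

lemma cross_ratio_eq_of_ratio_eq:
  assumes "x \<in> {0<..<1}" "a \<in> {0<..<1}" "y \<in> {0<..<1}" "b \<in> {0<..<1}"
    and "ratio x a = ratio y b"
  shows "cross_ratio x y (-1/2) 1 = cross_ratio b a (-1/2) 1"
proof -
  \<comment> \<open>Numerator and denominator share the positive divisor 1 + 2 s t, which
    cancels.\<close>
  have odds: "(3 - 2 * ratio s t) / ratio s t = (1 + 2 * s) * (1 + 2 * t) / ((1 - s) * (1 - t))"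
    if "s \<in> {0<..<1}" "t \<in> {0<..<1}" for s t
    using three_minus_two_ratio[of s t] one_plus_two_mult_pos[of s t] that
    by (simp add: ratio_def)
  have "(1 + 2 * x) * (1 + 2 * a) / ((1 - x) * (1 - a)) =
      (1 + 2 * y) * (1 + 2 * b) / ((1 - y) * (1 - b))"
    using odds[of x a] odds[of y b] assms by simp
  then have eq: "(1 + 2 * x) * (1 + 2 * a) * ((1 - y) * (1 - b)) =
      (1 + 2 * y) * (1 + 2 * b) * ((1 - x) * (1 - a))"
    using assms by (simp add: frac_eq_eq)
  have cr: "cross_ratio s t (-1/2) 1 = (1 + 2 * s) * (1 - t) / ((1 - s) * (1 + 2 * t))"
    if "s \<in> {0<..<1}" "t \<in> {0<..<1}" for s t
    using that unfolding cross_ratio_def by (simp add: divide_simps) (simp add: algebra_simps)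
  have "(1 + 2 * x) * (1 - y) * ((1 - b) * (1 + 2 * a)) =
      (1 + 2 * b) * (1 - a) * ((1 - x) * (1 + 2 * y))"
    using eq by (simp only: mult_ac)
  then show ?thesis
    unfolding cr[OF assms(1,3)] cr[OF assms(4,2)] using assms by (simp add: frac_eq_eq)
qed

theorem lemma1p3:
  fixes p q :: real
  assumes "1 < p" and "p < q"
  shows "(\<forall>x\<in>{0<..<1}. \<forall>y\<in>{0<..<1}.
            solves_S p q x y \<longleftrightarrow>
              (ell p x = ell q y \<and>
               ell (conj_exponent p) (x powr (p - 1)) = ell (conj_exponent q) (y powr (q - 1))))
       \<and> (\<forall>x\<in>{0<..<1}. \<forall>y\<in>{0<..<1}.
            solves_S p q x y \<longleftrightarrow>
              solves_S (conj_exponent q) (conj_exponent p) (y powr (q - 1)) (x powr (p - 1)))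
       \<and> (\<forall>x\<in>{0<..<1}. \<forall>y\<in>{0<..<1}. solves_S p q x y \<longrightarrow>
            cross_ratio x y (-1/2) 1 = cross_ratio (y powr (q - 1)) (x powr (p - 1)) (-1/2) 1)"
proof (intro conjI ballI impI)
  fix x y :: real
  assume xy: "x \<in> {0<..<1}" "y \<in> {0<..<1}"
  have q: "1 < q"
    using assms by simp
  show "solves_S p q x y \<longleftrightarrow>
      ell p x = ell q y \<and>
      ell (conj_exponent p) (x powr (p - 1)) = ell (conj_exponent q) (y powr (q - 1))"
    using solves_S_iff_ell[OF assms(1) q xy] .
  show "solves_S p q x y \<longleftrightarrow>
      solves_S (conj_exponent q) (conj_exponent p) (y powr (q - 1)) (x powr (p - 1))"
    using solves_S_conj_iff[OF assms(1) q xy] .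
  show "cross_ratio x y (-1/2) 1 = cross_ratio (y powr (q - 1)) (x powr (p - 1)) (-1/2) 1"
    if "solves_S p q x y"
    using that xy assms(1) q
    by (intro cross_ratio_eq_of_ratio_eq powr_minus_one_in_unit_interval)
      (simp_all add: solves_S_iff_ratio)
qed

end
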